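(* Let $A_k:=k^3$ for $k\ge0$, $a_k:=A_k-A_{k-1}$ for $k\ge1$, and $\gamma_k:=\frac{a_{k+1}}{A_{k+1}}=1-\bigl(\frac{k}{k+1}\bigr)^3=O(1/k)$. There is an absolute constant $C>0$ such that, for every sequence $\{x_k\}$ generated by the Contracting-Domain Newton Method II (defined in the context) with these $\gamma_k$, for all $k\ge1$, $$F(x_k)-F^*\;\le\;\ell_k\;\le\;C\,\frac{H_\nu D^{2+\nu}}{k^{1+\nu}}.$$
   Context: Problem: minimize $F(x)=f(x)+\psi(x)$ over $x\in\mathbb{R}^n$, with optimal value $F^*$, where $\psi:\mathbb{R}^n\to\mathbb{R}\cup\{+\infty\}$ is a proper closed convex function and $f$ is convex and twice continuously differentiable at every point of $\operatorname{dom}\psi=\{x:\psi(x)<+\infty\}$. $\langle\cdot,\cdot\rangle$ is the standard scalar product on $\mathbb{R}^n$ and $\|\cdot\|$ is an arbitrary fixed (possibly non-Euclidean) norm on $\mathbb{R}^n$, with dual norm $\|s\|_*=\sup_{\|h\|\le 1}\langle s,h\rangle$ and induced matrix norm $\|A\|=\sup_{\|h\|\le1}\|Ah\|_*$. The domain is bounded: $D:=\sup_{x,y\in\operatorname{dom}\psi}\|x-y\|<+\infty$. The Hessian of $f$ is Hölder continuous of degree $\nu\in[0,1]$ on $\operatorname{dom}\psi$ with constant $0\le H_\nu<+\infty$: $\|\nabla^2 f(x)-\nabla^2 f(y)\|\le H_\nu\|x-y\|^\nu$ for all $x,y\in\operatorname{dom}\psi$. Contracting-Domain Newton Method II, with coefficients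 $\gamma_k\in(0,1]$: choose $x_0\in\operatorname{dom}\psi$; for $k\ge0$ let $S_k(y):=\psi(y)$ if $y\in\gamma_k\operatorname{dom}\psi+(1-\gamma_k)x_k$ and $S_k(y):=+\infty$ otherwise, and take any $$x_{k+1}\in\operatorname{Argmin}_y\Bigl\{\langle\nabla f(x_k),y-x_k\rangle+\frac12\langle\nabla^2 f(x_k)(y-x_k),y-x_k\rangle+S_k(y)\Bigr\}.$$ For $k\ge1$, $\phi_k(x):=\sum_{i=1}^k a_i\bigl[f(x_i)+\langle\nabla f(x_i),x-x_i\rangle+\psi(x)\bigr]$, $\phi_k^*:=\min_x\phi_k(x)$, and $\ell_k:=F(x_k)-\phi_k^*/A_k$. An absolute constant is one independent of $k$, $n$, $\nu$, $H_\nu$, $D$, $f$, $\psi$, the norm and $x_0$. *)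

theory Defs
  imports
    "Jordan_Normal_Form.Matrix"
    "HOL-Library.Extended_Real"
    "HOL-Library.Landau_Symbols"
begin

text \<open>
  The constant of the rate estimate must not depend on the dimension, so the dimension \<open>n\<close> is
  quantified inside the theorem. Hence \<open>\<real>\<^sup>n\<close> is \<^term>\<open>carrier_vec n :: real vec set\<close>. This type
  carries no topology in the library, so norms, closedness and derivatives are spelled out
  relative to the carrier. Suprema and infima are taken in \<^typ>\<open>ereal\<close>.
\<close>

section \<open>Norms\<close>

definition norm_on :: "nat \<Rightarrow> (real vec \<Rightarrow> real) \<Rightarrow> bool" where
  "norm_on n N \<longleftrightarrow>
     (\<forall>v\<in>carrier_vec n. 0 \<le> N v) \<and>
     (\<forall>v\<in>carrier_vec n. N v = 0 \<longleftrightarrow> v = 0\<^sub>v n) \<and>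
     (\<forall>c. \<forall>v\<in>carrier_vec n. N (c \<cdot>\<^sub>v v) = \<bar>c\<bar> * N v) \<and>
     (\<forall>u\<in>carrier_vec n. \<forall>v\<in>carrier_vec n. N (u + v) \<le> N u + N v)"

definition dual_norm :: "nat \<Rightarrow> (real vec \<Rightarrow> real) \<Rightarrow> real vec \<Rightarrow> ereal" where
  "dual_norm n N s = (SUP h \<in> {h \<in> carrier_vec n. N h \<le> 1}. ereal (s \<bullet> h))"

definition induced_norm :: "nat \<Rightarrow> (real vec \<Rightarrow> real) \<Rightarrow> real mat \<Rightarrow> ereal" where
  "induced_norm n N A = (SUP h \<in> {h \<in> carrier_vec n. N h \<le> 1}. dual_norm n N (A *\<^sub>v h))"

definition euclid_norm :: "real vec \<Rightarrow> real" where
  "euclid_norm v = sqrt (v \<bullet> v)"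

section \<open>Differentiability\<close>

text \<open>
  Frechet derivatives. They are taken with respect to the Euclidean norm, which is no restriction
  as all norms on \<open>\<real>\<^sup>n\<close> are equivalent.
\<close>

definition has_gradient :: "nat \<Rightarrow> (real vec \<Rightarrow> real) \<Rightarrow> real vec \<Rightarrow> real vec \<Rightarrow> bool" where
  "has_gradient n f g x \<longleftrightarrow> g \<in> carrier_vec n \<and>
     (\<forall>\<epsilon>>0. \<exists>\<delta>>0. \<forall>y\<in>carrier_vec n. euclid_norm (y - x) < \<delta> \<longrightarrow>
        \<bar>f y - f x - g \<bullet> (y - x)\<bar> \<le> \<epsilon> * euclid_norm (y - x))"

definition has_jacobian :: "nat \<Rightarrow> (real vec \<Rightarrow> real vec) \<Rightarrow> real mat \<Rightarrow> real vec \<Rightarrow> bool" where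
  "has_jacobian n G J x \<longleftrightarrow> J \<in> carrier_mat n n \<and>
     (\<forall>\<epsilon>>0. \<exists>\<delta>>0. \<forall>y\<in>carrier_vec n. euclid_norm (y - x) < \<delta> \<longrightarrow>
        euclid_norm (G y - G x - J *\<^sub>v (y - x)) \<le> \<epsilon> * euclid_norm (y - x))"

definition mat_continuous_at :: "nat \<Rightarrow> (real vec \<Rightarrow> real mat) \<Rightarrow> real vec \<Rightarrow> bool" where
  "mat_continuous_at n M x \<longleftrightarrow>
     (\<forall>\<epsilon>>0. \<exists>\<delta>>0. \<forall>y\<in>carrier_vec n. euclid_norm (y - x) < \<delta> \<longrightarrow>
        (\<forall>i<n. \<forall>j<n. \<bar>M y $$ (i, j) - M x $$ (i, j)\<bar> < \<epsilon>))"

text \<open>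
  \<open>f\<close> is twice continuously differentiable in a neighbourhood of \<open>x\<close> in \<open>\<real>\<^sup>n\<close>, with gradient \<open>G\<close>
  and Hessian \<open>M\<close> there.
\<close>

definition C2_at ::
  "nat \<Rightarrow> (real vec \<Rightarrow> real) \<Rightarrow> (real vec \<Rightarrow> real vec) \<Rightarrow> (real vec \<Rightarrow> real mat) \<Rightarrow> real vec \<Rightarrow> bool"
  where
  "C2_at n f G M x \<longleftrightarrow>
     (\<exists>r>0. \<forall>y\<in>carrier_vec n. euclid_norm (y - x) < r \<longrightarrow>
        has_gradient n f (G y) y \<and> has_jacobian n G (M y) y \<and> mat_continuous_at n M y)"

section \<open>Convex functions\<close>

definition edom :: "nat \<Rightarrow> (real vec \<Rightarrow> ereal) \<Rightarrow> real vec set" where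
  "edom n \<psi> = {x \<in> carrier_vec n. \<psi> x < \<infinity>}"

definition proper_fun :: "nat \<Rightarrow> (real vec \<Rightarrow> ereal) \<Rightarrow> bool" where
  "proper_fun n \<psi> \<longleftrightarrow> (\<forall>x\<in>carrier_vec n. \<psi> x \<noteq> -\<infinity>) \<and> edom n \<psi> \<noteq> {}"

text \<open>Sequential closedness of the epigraph in \<open>\<real>\<^sup>n \<times> \<real>\<close>.\<close>

definition closed_fun :: "nat \<Rightarrow> (real vec \<Rightarrow> ereal) \<Rightarrow> bool" where
  "closed_fun n \<psi> \<longleftrightarrow>
     (\<forall>u t x s. (\<forall>j. u j \<in> carrier_vec n \<and> \<psi> (u j) \<le> ereal (t j)) \<and> x \<in> carrier_vec n \<and>
        (\<forall>i<n. (\<lambda>j. u j $ i) \<longlonglongrightarrow> x $ i) \<and> t \<longlonglongrightarrow> s \<longrightarrow> \<psi> x \<le> ereal s)"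

text \<open>At \<open>\<tau> \<in> {0, 1}\<close> this uses the convention \<open>0 * \<infinity> = 0\<close> of \<^typ>\<open>ereal\<close>.\<close>

definition convex_efun :: "nat \<Rightarrow> (real vec \<Rightarrow> ereal) \<Rightarrow> bool" where
  "convex_efun n \<psi> \<longleftrightarrow>
     (\<forall>x\<in>carrier_vec n. \<forall>y\<in>carrier_vec n. \<forall>\<tau>\<in>{0..1}.
        \<psi> (\<tau> \<cdot>\<^sub>v x + (1 - \<tau>) \<cdot>\<^sub>v y) \<le> ereal \<tau> * \<psi> x + ereal (1 - \<tau>) * \<psi> y)"

definition convex_fun_on :: "real vec set \<Rightarrow> (real vec \<Rightarrow> real) \<Rightarrow> bool" where
  "convex_fun_on S f \<longleftrightarrow>
     (\<forall>x\<in>S. \<forall>y\<in>S. \<forall>\<tau>\<in>{0..1}. f (\<tau> \<cdot>\<^sub>v x + (1 - \<tau>) \<cdot>\<^sub>v y) \<le> \<tau> * f x + (1 - \<tau>) * f y)"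

section \<open>The composite problem and the method\<close>

definition objective :: "(real vec \<Rightarrow> real) \<Rightarrow> (real vec \<Rightarrow> ereal) \<Rightarrow> real vec \<Rightarrow> ereal" where
  "objective f \<psi> x = ereal (f x) + \<psi> x"

definition opt_value :: "nat \<Rightarrow> (real vec \<Rightarrow> real) \<Rightarrow> (real vec \<Rightarrow> ereal) \<Rightarrow> ereal" where
  "opt_value n f \<psi> = (INF x \<in> carrier_vec n. objective f \<psi> x)"

definition contracted_psi :: "nat \<Rightarrow> (real vec \<Rightarrow> ereal) \<Rightarrow> real \<Rightarrow> real vec \<Rightarrow> real vec \<Rightarrow> ereal" where
  "contracted_psi n \<psi> \<gamma> x y =
     (if y \<in> {\<gamma> \<cdot>\<^sub>v v + (1 - \<gamma>) \<cdot>\<^sub>v x | v. v \<in> edom n \<psi>} then \<psi> y else \<infinity>)"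

definition newton_model ::
  "nat \<Rightarrow> (real vec \<Rightarrow> real vec) \<Rightarrow> (real vec \<Rightarrow> real mat) \<Rightarrow> (real vec \<Rightarrow> ereal) \<Rightarrow> real \<Rightarrow>
   real vec \<Rightarrow> real vec \<Rightarrow> ereal" where
  "newton_model n G M \<psi> \<gamma> x y =
     ereal (G x \<bullet> (y - x) + 1 / 2 * ((M x *\<^sub>v (y - x)) \<bullet> (y - x))) + contracted_psi n \<psi> \<gamma> x y"

definition argmin_on :: "real vec set \<Rightarrow> (real vec \<Rightarrow> ereal) \<Rightarrow> real vec set" where
  "argmin_on S h = {y \<in> S. \<forall>z\<in>S. h y \<le> h z}"

definition contracting_newton_II ::
  "nat \<Rightarrow> (real vec \<Rightarrow> real vec) \<Rightarrow> (real vec \<Rightarrow> real mat) \<Rightarrow> (real vec \<Rightarrow> ereal) \<Rightarrow> (nat \<Rightarrow> real) \<Rightarrow>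
   (nat \<Rightarrow> real vec) \<Rightarrow> bool" where
  "contracting_newton_II n G M \<psi> \<gamma> x \<longleftrightarrow>
     x 0 \<in> edom n \<psi> \<and>
     (\<forall>k. x (Suc k) \<in> argmin_on (carrier_vec n) (newton_model n G M \<psi> (\<gamma> k) (x k)))"

section \<open>Coefficients and estimating functions\<close>

definition A_coef :: "nat \<Rightarrow> real" where
  "A_coef k = real k ^ 3"

definition a_coef :: "nat \<Rightarrow> real" where  \<comment> \<open>meaningful for \<open>k \<ge> 1\<close> only\<close>
  "a_coef k = A_coef k - A_coef (k - 1)"

definition gamma_coef :: "nat \<Rightarrow> real" where
  "gamma_coef k = a_coef (k + 1) / A_coef (k + 1)"

definition est_fun ::
  "(real vec \<Rightarrow> real) \<Rightarrow> (real vec \<Rightarrow> real vec) \<Rightarrow> (real vec \<Rightarrow> ereal) \<Rightarrow> (nat \<Rightarrow> real vec) \<Rightarrow>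
   nat \<Rightarrow> real vec \<Rightarrow> ereal" where
  "est_fun f G \<psi> x k y =
     (\<Sum>i=1..k. ereal (a_coef i) * (ereal (f (x i) + G (x i) \<bullet> (y - x i)) + \<psi> y))"

definition est_min ::
  "nat \<Rightarrow> (real vec \<Rightarrow> real) \<Rightarrow> (real vec \<Rightarrow> real vec) \<Rightarrow> (real vec \<Rightarrow> ereal) \<Rightarrow> (nat \<Rightarrow> real vec) \<Rightarrow>
   nat \<Rightarrow> ereal" where
  "est_min n f G \<psi> x k = (INF y \<in> carrier_vec n. est_fun f G \<psi> x k y)"

definition accuracy_cert ::
  "nat \<Rightarrow> (real vec \<Rightarrow> real) \<Rightarrow> (real vec \<Rightarrow> real vec) \<Rightarrow> (real vec \<Rightarrow> ereal) \<Rightarrow> (nat \<Rightarrow> real vec) \<Rightarrow>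
   nat \<Rightarrow> ereal" where
  "accuracy_cert n f G \<psi> x k = objective f \<psi> (x k) - est_min n f G \<psi> x k / ereal (A_coef k)"

end

theory Submission
  imports Defs
begin

text \<open>
  Write \<open>F = f + \<psi>\<close> and \<open>\<gamma> = \<gamma>\<^sub>k\<close>. The proof shows by induction on \<open>k\<close> that, everywhere on
  \<open>dom \<psi>\<close>, the estimating function satisfies \<open>\<phi>\<^sub>k \<ge> A\<^sub>k F(x\<^sub>k) - B\<^sub>k\<close> with an error \<open>B\<^sub>k\<close> of order
  \<open>H D\<^bsup>2+\<nu>\<^esup> k\<^bsup>2-\<nu>\<^esup>\<close>. Minimising over the domain and dividing by \<open>A\<^sub>k = k\<^sup>3\<close> bounds the certificate.
  That the certificate dominates the residual is the convexity of \<open>f\<close>: each linearisation lies below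
  \<open>f\<close>, so \<open>\<phi>\<^sub>k \<le> A\<^sub>k F\<close> on the domain.

  For the induction step take \<open>v\<close> in the domain and the point \<open>y = \<gamma> v + (1 - \<gamma>) x\<^sub>k\<close>, which is feasible
  for the subproblem that defines \<open>x\<^sub>k\<^sub>+\<^sub>1\<close>. Since \<open>A\<^sub>k = (1 - \<gamma>) A\<^sub>k\<^sub>+\<^sub>1\<close> and \<open>a\<^sub>k\<^sub>+\<^sub>1 = \<gamma> A\<^sub>k\<^sub>+\<^sub>1\<close>, bounding
  \<open>f(x\<^sub>k)\<close> below by the linearisation at \<open>x\<^sub>k\<^sub>+\<^sub>1\<close> and using the convexity of \<open>\<psi>\<close> merges the old and the
  new term into \<open>A\<^sub>k\<^sub>+\<^sub>1\<close> times the linearisation of \<open>f\<close> at \<open>x\<^sub>k\<^sub>+\<^sub>1\<close> plus \<open>\<psi>\<close>, evaluated at \<open>y\<close>.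
  The first-order condition for the subproblem
  (\<open>first_order_optimality\<close>) compares it with \<open>F(x\<^sub>k\<^sub>+\<^sub>1)\<close>, up to
  \<open>\<langle>\<nabla>f(x\<^sub>k\<^sub>+\<^sub>1) - \<nabla>f(x\<^sub>k) - \<nabla>\<^sup>2f(x\<^sub>k)(x\<^sub>k\<^sub>+\<^sub>1 - x\<^sub>k), y - x\<^sub>k\<^sub>+\<^sub>1\<rangle>\<close>. Hoelder continuity
  (\<open>grad_remainder\<close>) bounds this by \<open>H \<parallel>x\<^sub>k\<^sub>+\<^sub>1 - x\<^sub>k\<parallel>\<^bsup>1+\<nu>\<^esup> \<parallel>y - x\<^sub>k\<^sub>+\<^sub>1\<parallel>\<close>, and contracting the domain
  makes both distances at most \<open>\<gamma> D\<close>. As \<open>\<gamma> \<le> 3/(k+1)\<close>, a step costs at most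
  \<open>A\<^sub>k\<^sub>+\<^sub>1 H (\<gamma> D)\<^bsup>2+\<nu>\<^esup> \<le> 27 H D\<^bsup>2+\<nu>\<^esup> (k+1)\<^bsup>1-\<nu>\<^esup>\<close>; the exponent \<open>1 - \<nu>\<close> is nonnegative, so \<open>k\<close> steps cost
  at most \<open>k\<close> times the last one. This gives the constant \<open>C = 27\<close>.

  The first-order condition contains the symmetric part of the Hessian while the remainder contains
  the Hessian itself. Its symmetry is therefore derived from the differentiability assumptions
  (\<open>C2_at_hessian_symmetric\<close>).
\<close>

section \<open>Euclidean geometry of real vectors\<close>

lemma self_scalar_prod_nonneg: "0 \<le> (u::real vec) \<bullet> u"
  by (auto simp: scalar_prod_def intro: sum_nonneg)

lemma euclid_norm_nonneg: "0 \<le> euclid_norm u"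
  by (simp add: euclid_norm_def self_scalar_prod_nonneg)

lemma abs_scalar_prod_le_euclid_norm:
  assumes u: "u \<in> carrier_vec n" and v: "v \<in> carrier_vec n"
  shows "\<bar>u \<bullet> v\<bar> \<le> euclid_norm u * euclid_norm v"
proof -
  have quad: "0 \<le> u \<bullet> u - 2 * t * (u \<bullet> v) + t\<^sup>2 * (v \<bullet> v)" for t
  proof -
    have "(u - t \<cdot>\<^sub>v v) \<bullet> (u - t \<cdot>\<^sub>v v) = u \<bullet> u - 2 * t * (u \<bullet> v) + t\<^sup>2 * (v \<bullet> v)"
      using u v comm_scalar_prod[OF u v]
      by (simp add: minus_scalar_prod_distrib[of _ n] scalar_prod_minus_distrib[of _ n]
          power2_eq_square algebra_simps)
    then show ?thesis using self_scalar_prod_nonneg by metis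
  qed
  have "(u \<bullet> v)\<^sup>2 \<le> (u \<bullet> u) * (v \<bullet> v)"
  proof (cases "v \<bullet> v = 0")
    case True
    have "u \<bullet> v = 0"
    proof (rule ccontr)
      assume "u \<bullet> v \<noteq> 0"
      then show False using quad[of "(u \<bullet> u + 1) / (2 * (u \<bullet> v))"] True by simp
    qed
    then show ?thesis using True by simp
  next
    case False
    then have pos: "v \<bullet> v > 0" using self_scalar_prod_nonneg[of v] by simp
    have "0 \<le> u \<bullet> u - (u \<bullet> v)\<^sup>2 / (v \<bullet> v)"
      using quad[of "(u \<bullet> v) / (v \<bullet> v)"] pos by (simp add: field_simps power2_eq_square)
    then show ?thesis using pos by (simp add: field_simps)
  qed
  then have "sqrt ((u \<bullet> v)\<^sup>2) \<le> sqrt ((u \<bullet> u) * (v \<bullet> v))"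
    by (rule real_sqrt_le_mono)
  then show ?thesis by (simp add: euclid_norm_def real_sqrt_mult)
qed

lemma euclid_norm_smult: "euclid_norm (c \<cdot>\<^sub>v v) = \<bar>c\<bar> * euclid_norm v"
proof -
  have "(c \<cdot>\<^sub>v v) \<bullet> (c \<cdot>\<^sub>v v) = c\<^sup>2 * (v \<bullet> v)"
    by (simp add: power2_eq_square)
  then show ?thesis by (simp add: euclid_norm_def real_sqrt_mult)
qed

lemma euclid_norm_triangle:
  assumes u: "u \<in> carrier_vec n" and v: "v \<in> carrier_vec n"
  shows "euclid_norm (u + v) \<le> euclid_norm u + euclid_norm v"
proof -
  have sq: "(euclid_norm w)\<^sup>2 = w \<bullet> w" for w
    by (simp add: euclid_norm_def self_scalar_prod_nonneg)
  have "(euclid_norm (u + v))\<^sup>2 = u \<bullet> u + 2 * (u \<bullet> v) + v \<bullet> v"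
    using u v comm_scalar_prod[OF u v]
    by (simp add: sq add_scalar_prod_distrib[of _ n] scalar_prod_add_distrib[of _ n])
  also have "\<dots> \<le> (euclid_norm u + euclid_norm v)\<^sup>2"
    using abs_scalar_prod_le_euclid_norm[OF u v] by (simp add: power2_sum sq)
  finally show ?thesis
    by (rule power2_le_imp_le) (simp add: euclid_norm_nonneg)
qed

section \<open>Derivatives along lines\<close>

text \<open>
  The passage from minimality to a first-order condition: \<open>t p + t\<^sup>2 q\<close> bounds the change of a
  quadratic model after a fraction \<open>t\<close> of a feasible segment, and \<open>p\<close> dominates for small \<open>t\<close>.
\<close>

lemma nonneg_linear_coeff:
  fixes p q :: real
  assumes "\<And>t. 0 < t \<Longrightarrow> t \<le> 1 \<Longrightarrow> 0 \<le> t * p + t\<^sup>2 * q"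
  shows "0 \<le> p"
proof (rule ccontr)
  assume "\<not> 0 \<le> p"
  then have p: "p < 0" by simp
  define t where "t = min 1 (- p / (2 * (\<bar>q\<bar> + 1)))"
  have m: "0 < 2 * (\<bar>q\<bar> + 1)" by simp
  have t: "0 < t" "t \<le> 1" using divide_pos_pos[OF _ m, of "- p"] p by (simp_all only: t_def) auto
  have "t * (2 * (\<bar>q\<bar> + 1)) \<le> - p"
    using pos_le_divide_eq[OF m, of t "- p"] by (simp only: t_def min.cobounded2)
  moreover have "t * q \<le> t * (\<bar>q\<bar> + 1)" using t by (intro mult_left_mono) auto
  ultimately have "p + t * q < 0" using p by linarith
  then have "t * (p + t * q) < 0" using t by (simp add: mult_pos_neg)
  then show False using assms[OF t(1,2)] by (simp add: power2_eq_square algebra_simps)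
qed

text \<open>
  Restricting to a line turns gradients into ordinary derivatives, so that the one-dimensional mean
  value theorem applies.
\<close>

lemma has_gradient_line:
  assumes x: "x \<in> carrier_vec n" and d: "d \<in> carrier_vec n"
    and grad: "has_gradient n f g (x + t \<cdot>\<^sub>v d)"
  shows "((\<lambda>s. f (x + s \<cdot>\<^sub>v d)) has_real_derivative g \<bullet> d) (at t)"
  unfolding has_field_derivative_iff
proof (rule LIM_I)
  fix r :: real assume r: "r > 0"
  define c where "c = euclid_norm d + 1"
  have c: "c > 0" "euclid_norm d < c" using euclid_norm_nonneg[of d] by (auto simp: c_def)
  have g: "g \<in> carrier_vec n" using grad by (simp add: has_gradient_def)
  obtain \<delta> where \<delta>: "\<delta> > 0" and bound: "\<And>y. y \<in> carrier_vec n \<Longrightarrow> euclid_norm (y - (x + t \<cdot>\<^sub>v d)) < \<delta> \<Longrightarrow>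
      \<bar>f y - f (x + t \<cdot>\<^sub>v d) - g \<bullet> (y - (x + t \<cdot>\<^sub>v d))\<bar> \<le> r / c * euclid_norm (y - (x + t \<cdot>\<^sub>v d))"
    using grad divide_pos_pos[OF r c(1)] unfolding has_gradient_def by blast
  show "\<exists>s>0. \<forall>z. z \<noteq> t \<and> norm (z - t) < s \<longrightarrow>
     norm ((f (x + z \<cdot>\<^sub>v d) - f (x + t \<cdot>\<^sub>v d)) / (z - t) - g \<bullet> d) < r"
  proof (intro exI[of _ "\<delta> / c"] conjI allI impI)
    show "\<delta> / c > 0" using \<delta> c by simp
    fix z assume z: "z \<noteq> t \<and> norm (z - t) < \<delta> / c"
    have diff: "x + z \<cdot>\<^sub>v d - (x + t \<cdot>\<^sub>v d) = (z - t) \<cdot>\<^sub>v d"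
      using x d by (intro eq_vecI) (auto simp: algebra_simps)
    have "\<bar>z - t\<bar> * euclid_norm d \<le> \<bar>z - t\<bar> * c" using c by (intro mult_left_mono) auto
    also have "\<dots> < \<delta>" using z c by (simp add: field_simps)
    finally have "\<bar>f (x + z \<cdot>\<^sub>v d) - f (x + t \<cdot>\<^sub>v d) - (z - t) * (g \<bullet> d)\<bar>
        \<le> r / c * (\<bar>z - t\<bar> * euclid_norm d)"
      using bound[of "x + z \<cdot>\<^sub>v d"] x d g by (simp add: diff euclid_norm_smult)
    also have "\<dots> < r / c * (\<bar>z - t\<bar> * c)"
      using c r z by (intro mult_strict_left_mono) auto
    also have "\<dots> = r * \<bar>z - t\<bar>" using c by simp
    finally have "\<bar>f (x + z \<cdot>\<^sub>v d) - f (x + t \<cdot>\<^sub>v d) - (z - t) * (g \<bullet> d)\<bar> / \<bar>z - t\<bar> < r"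
      using z by (simp add: field_simps)
    moreover have "(f (x + z \<cdot>\<^sub>v d) - f (x + t \<cdot>\<^sub>v d)) / (z - t) - g \<bullet> d
        = (f (x + z \<cdot>\<^sub>v d) - f (x + t \<cdot>\<^sub>v d) - (z - t) * (g \<bullet> d)) / (z - t)"
      using z by (simp add: field_simps)
    ultimately show "norm ((f (x + z \<cdot>\<^sub>v d) - f (x + t \<cdot>\<^sub>v d)) / (z - t) - g \<bullet> d) < r"
      by (simp add: abs_divide)
  qed
qed

lemma transpose_mult_scalar_prod:
  fixes M :: "real mat"
  assumes "M \<in> carrier_mat n n" "b \<in> carrier_vec n" "d \<in> carrier_vec n"
  shows "(transpose_mat M *\<^sub>v b) \<bullet> d = (M *\<^sub>v d) \<bullet> b"
  using assms by (metis comm_scalar_prod mult_mat_vec_carrier transpose_carrier_mat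
      transpose_vec_mult_scalar)

text \<open>
  Testing a vector field against a fixed vector reduces statements on the Hessian to statements on
  gradients of scalar functions, to which the line lemma applies again.
\<close>

lemma has_jacobian_imp_has_gradient:
  assumes b: "b \<in> carrier_vec n" and x: "x \<in> carrier_vec n" and Gx: "G x \<in> carrier_vec n"
    and jac: "has_jacobian n G M x"
  shows "has_gradient n (\<lambda>y. G y \<bullet> b) (transpose_mat M *\<^sub>v b) x"
  unfolding has_gradient_def
proof (intro conjI allI impI)
  have M: "M \<in> carrier_mat n n" using jac by (simp add: has_jacobian_def)
  then show "transpose_mat M *\<^sub>v b \<in> carrier_vec n" using b by simp
  fix \<epsilon> :: real assume \<epsilon>: "\<epsilon> > 0"
  define c where "c = euclid_norm b + 1"
  have c: "c > 0" "euclid_norm b \<le> c" using euclid_norm_nonneg[of b] by (auto simp: c_def)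
  obtain \<delta> where \<delta>: "\<delta> > 0" and bound: "\<And>y. y \<in> carrier_vec n \<Longrightarrow> euclid_norm (y - x) < \<delta> \<Longrightarrow>
      euclid_norm (G y - G x - M *\<^sub>v (y - x)) \<le> \<epsilon> / c * euclid_norm (y - x)"
    using jac divide_pos_pos[OF \<epsilon> c(1)] unfolding has_jacobian_def by blast
  show "\<exists>\<delta>>0. \<forall>y\<in>carrier_vec n. euclid_norm (y - x) < \<delta> \<longrightarrow>
      \<bar>G y \<bullet> b - G x \<bullet> b - (transpose_mat M *\<^sub>v b) \<bullet> (y - x)\<bar> \<le> \<epsilon> * euclid_norm (y - x)"
  proof (intro exI[of _ \<delta>] conjI ballI impI \<delta>)
    fix y :: "real vec" assume y: "y \<in> carrier_vec n" "euclid_norm (y - x) < \<delta>"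
    define w where "w = M *\<^sub>v (y - x)"
    have w: "w \<in> carrier_vec n" using M x y by (simp add: w_def)
    have R: "G y - G x - w \<in> carrier_vec n" using carrier_vecD[OF w] by (intro carrier_vecI) simp
    have "(G y - G x - w) \<bullet> b = G y \<bullet> b - G x \<bullet> b - w \<bullet> b"
      using carrier_vecD[OF b] carrier_vecD[OF Gx] carrier_vecD[OF w]
      by (simp add: scalar_prod_def left_diff_distrib sum_subtractf)
    moreover have "(transpose_mat M *\<^sub>v b) \<bullet> (y - x) = w \<bullet> b"
      unfolding w_def by (rule transpose_mult_scalar_prod[OF M b]) (use x y in simp)
    ultimately have "\<bar>G y \<bullet> b - G x \<bullet> b - (transpose_mat M *\<^sub>v b) \<bullet> (y - x)\<bar>
        \<le> euclid_norm (G y - G x - w) * euclid_norm b"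
      using abs_scalar_prod_le_euclid_norm[OF R b] by simp
    also have "\<dots> \<le> (\<epsilon> / c * euclid_norm (y - x)) * c"
      using bound[OF y] c \<epsilon> euclid_norm_nonneg
      by (intro mult_mono) (auto simp: w_def)
    finally show "\<bar>G y \<bullet> b - G x \<bullet> b - (transpose_mat M *\<^sub>v b) \<bullet> (y - x)\<bar> \<le> \<epsilon> * euclid_norm (y - x)"
      using c by simp
  qed
qed

section \<open>Symmetry of the Hessian\<close>

text \<open>
  The expression on the left is the second difference of \<open>f\<close> over a parallelogram with sides \<open>t a\<close> and
  \<open>t b\<close>. It does not distinguish \<open>a\<close> from \<open>b\<close>, whereas its limit after division by \<open>t\<^sup>2\<close> is
  computed here by differentiating first along \<open>a\<close> and then along \<open>b\<close>; comparing both orders yields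
  the symmetry of second derivatives.
\<close>

lemma second_difference_estimate:
  assumes x: "x \<in> carrier_vec n" and a: "a \<in> carrier_vec n" and b: "b \<in> carrier_vec n"
    and r: "r > 0"
    and grad: "\<And>y. y \<in> carrier_vec n \<Longrightarrow> euclid_norm (y - x) < r \<Longrightarrow> has_gradient n f (G y) y"
    and h: "has_gradient n (\<lambda>y. G y \<bullet> a) h x"
    and \<epsilon>: "\<epsilon> > 0"
  shows "\<exists>\<delta>>0. \<forall>t. 0 < t \<and> t < \<delta> \<longrightarrow>
    \<bar>f (x + t \<cdot>\<^sub>v b + t \<cdot>\<^sub>v a) - f (x + t \<cdot>\<^sub>v a) - f (x + t \<cdot>\<^sub>v b) + f x - t\<^sup>2 * (h \<bullet> b)\<bar> \<le> \<epsilon> * t\<^sup>2"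
proof -
  \<comment> \<open>\<open>t K\<close> bounds the sum of the distances to \<open>x\<close> of the two points at which the mean value theorem
  evaluates \<open>G\<close>.\<close>
  define K where "K = 2 * euclid_norm a + euclid_norm b + 1"
  have K: "K > 0" using euclid_norm_nonneg[of a] euclid_norm_nonneg[of b] by (simp add: K_def)
  have hc: "h \<in> carrier_vec n" using h by (simp add: has_gradient_def)
  obtain \<delta> where \<delta>: "\<delta> > 0" and bound: "\<And>y. y \<in> carrier_vec n \<Longrightarrow> euclid_norm (y - x) < \<delta> \<Longrightarrow>
      \<bar>G y \<bullet> a - G x \<bullet> a - h \<bullet> (y - x)\<bar> \<le> \<epsilon> / K * euclid_norm (y - x)"
    using h divide_pos_pos[OF \<epsilon> K] unfolding has_gradient_def by blast
  show ?thesis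
  proof (intro exI[of _ "min r \<delta> / K"] conjI allI impI)
    show "min r \<delta> / K > 0" using r \<delta> K by simp
    fix t assume "0 < t \<and> t < min r \<delta> / K"
    then have t: "0 < t" "t * K < r" "t * K < \<delta>" using K by (auto simp: field_simps)
    have near: "euclid_norm (q \<cdot>\<^sub>v b + s \<cdot>\<^sub>v a) \<le> q * euclid_norm b + t * euclid_norm a"
      if "0 \<le> q" "0 \<le> s" "s \<le> t" for q s
    proof -
      have "euclid_norm (q \<cdot>\<^sub>v b + s \<cdot>\<^sub>v a) \<le> q * euclid_norm b + s * euclid_norm a"
        using euclid_norm_triangle[of "q \<cdot>\<^sub>v b" n "s \<cdot>\<^sub>v a"] a b that by (simp add: euclid_norm_smult)
      also have "\<dots> \<le> q * euclid_norm b + t * euclid_norm a"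
        using that euclid_norm_nonneg[of a] by (simp add: mult_right_mono)
      finally show ?thesis .
    qed
    have shift: "x + q \<cdot>\<^sub>v b + s \<cdot>\<^sub>v a - x = q \<cdot>\<^sub>v b + s \<cdot>\<^sub>v a" for q s
      using x a b by (intro eq_vecI) auto
    have tK: "q * euclid_norm b + t * euclid_norm a \<le> t * K" if "q \<le> t" for q
    proof -
      have "q * euclid_norm b \<le> t * euclid_norm b"
        using that euclid_norm_nonneg[of b] by (simp add: mult_right_mono)
      moreover have "t * K = t * euclid_norm b + t * euclid_norm a + t * euclid_norm a + t"
        by (simp add: K_def algebra_simps)
      moreover have "0 \<le> t * euclid_norm a" using t euclid_norm_nonneg[of a] by simp
      ultimately show ?thesis using t by linarith
    qed
    have close: "euclid_norm (x + q \<cdot>\<^sub>v b + s \<cdot>\<^sub>v a - x) \<le> t * K"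
      if "0 \<le> q" "q \<le> t" "0 \<le> s" "s \<le> t" for q s
      using near[of q s] tK[of q] that by (simp add: shift)
    define \<phi> where "\<phi> s = f (x + t \<cdot>\<^sub>v b + s \<cdot>\<^sub>v a) - f (x + 0 \<cdot>\<^sub>v b + s \<cdot>\<^sub>v a)" for s
    have der: "(\<phi> has_real_derivative
        (G (x + t \<cdot>\<^sub>v b + s \<cdot>\<^sub>v a) \<bullet> a - G (x + 0 \<cdot>\<^sub>v b + s \<cdot>\<^sub>v a) \<bullet> a)) (at s)"
      if "0 \<le> s" "s \<le> t" for s
      unfolding \<phi>_def
    proof (intro DERIV_diff has_gradient_line)
      have near_x: "has_gradient n f (G (x + q \<cdot>\<^sub>v b + s \<cdot>\<^sub>v a)) (x + q \<cdot>\<^sub>v b + s \<cdot>\<^sub>v a)"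
        if "0 \<le> q" "q \<le> t" for q
        using close[of q s] that \<open>0 \<le> s\<close> \<open>s \<le> t\<close> t x a b by (intro grad) auto
      show "has_gradient n f (G (x + t \<cdot>\<^sub>v b + s \<cdot>\<^sub>v a)) (x + t \<cdot>\<^sub>v b + s \<cdot>\<^sub>v a)"
        by (rule near_x) (use t in simp_all)
      show "has_gradient n f (G (x + 0 \<cdot>\<^sub>v b + s \<cdot>\<^sub>v a)) (x + 0 \<cdot>\<^sub>v b + s \<cdot>\<^sub>v a)"
        by (rule near_x) (use t in simp_all)
    qed (use x a b in simp_all)
    obtain s where s: "0 < s" "s < t"
      and mv: "\<phi> t - \<phi> 0 = t * (G (x + t \<cdot>\<^sub>v b + s \<cdot>\<^sub>v a) \<bullet> a - G (x + 0 \<cdot>\<^sub>v b + s \<cdot>\<^sub>v a) \<bullet> a)"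
      using MVT2[OF t(1) der] by auto
    \<comment> \<open>\<open>Q q\<close> is the error of the linear approximation of \<open>G \<bullet> a\<close> at the point with coordinates \<open>q, s\<close>;
    in the difference of two such errors the terms with \<open>s\<close> cancel.\<close>
    define Q where "Q q = G (x + q \<cdot>\<^sub>v b + s \<cdot>\<^sub>v a) \<bullet> a - G x \<bullet> a - (q * (h \<bullet> b) + s * (h \<bullet> a))" for q
    have Q: "\<bar>Q q\<bar> \<le> \<epsilon> / K * (q * euclid_norm b + t * euclid_norm a)" if "0 \<le> q" "q \<le> t" for q
    proof -
      have "h \<bullet> (q \<cdot>\<^sub>v b + s \<cdot>\<^sub>v a) = q * (h \<bullet> b) + s * (h \<bullet> a)"
        using hc a b by (simp add: scalar_prod_add_distrib[of _ n])
      then have "\<bar>Q q\<bar> \<le> \<epsilon> / K * euclid_norm (q \<cdot>\<^sub>v b + s \<cdot>\<^sub>v a)"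
        using bound[of "x + q \<cdot>\<^sub>v b + s \<cdot>\<^sub>v a"] close[of q s] s t that x a b
        unfolding Q_def shift by simp
      also have "\<dots> \<le> \<epsilon> / K * (q * euclid_norm b + t * euclid_norm a)"
        using near[of q s] s that \<epsilon> K by (intro mult_left_mono) auto
      finally show ?thesis .
    qed
    have "\<bar>Q t - Q 0\<bar> \<le> \<epsilon> / K * (t * euclid_norm b + t * euclid_norm a) + \<epsilon> / K * (t * euclid_norm a)"
      using Q[of t] Q[of 0] t by simp
    also have "\<dots> \<le> \<epsilon> / K * (t * K)"
      unfolding distrib_left[symmetric]
      using \<epsilon> K t by (intro mult_left_mono) (auto simp: K_def algebra_simps)
    also have "\<dots> = \<epsilon> * t" using K by simp
    finally have "t * \<bar>Q t - Q 0\<bar> \<le> t * (\<epsilon> * t)" using t by (intro mult_left_mono) auto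
    then have small: "\<bar>t * (Q t - Q 0)\<bar> \<le> \<epsilon> * t\<^sup>2"
      using t by (simp add: abs_mult power2_eq_square mult_ac)
    have main: "\<phi> t - \<phi> 0 - t\<^sup>2 * (h \<bullet> b) = t * (Q t - Q 0)"
      unfolding mv Q_def by (simp add: power2_eq_square algebra_simps)
    have "x + 0 \<cdot>\<^sub>v b + t \<cdot>\<^sub>v a = x + t \<cdot>\<^sub>v a" "x + t \<cdot>\<^sub>v b + 0 \<cdot>\<^sub>v a = x + t \<cdot>\<^sub>v b"
      "x + 0 \<cdot>\<^sub>v b + 0 \<cdot>\<^sub>v a = x"
      using x a b by (auto intro!: eq_vecI)
    then have "f (x + t \<cdot>\<^sub>v b + t \<cdot>\<^sub>v a) - f (x + t \<cdot>\<^sub>v a) - f (x + t \<cdot>\<^sub>v b) + f x = \<phi> t - \<phi> 0"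
      by (simp add: \<phi>_def)
    then show "\<bar>f (x + t \<cdot>\<^sub>v b + t \<cdot>\<^sub>v a) - f (x + t \<cdot>\<^sub>v a) - f (x + t \<cdot>\<^sub>v b) + f x - t\<^sup>2 * (h \<bullet> b)\<bar>
        \<le> \<epsilon> * t\<^sup>2"
      using small main by presburger
  qed
qed

lemma C2_at_self:
  assumes "C2_at n f G M x" "x \<in> carrier_vec n"
  shows "has_gradient n f (G x) x" "has_jacobian n G (M x) x" "G x \<in> carrier_vec n"
    "M x \<in> carrier_mat n n"
proof -
  have "x - x = 0\<^sub>v n" using assms by (intro eq_vecI) auto
  then have "euclid_norm (x - x) = 0" by (simp add: euclid_norm_def)
  then show *: "has_gradient n f (G x) x" "has_jacobian n G (M x) x"
    using assms unfolding C2_at_def by auto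
  show "G x \<in> carrier_vec n" "M x \<in> carrier_mat n n"
    using * by (auto simp: has_gradient_def has_jacobian_def)
qed

lemma C2_at_hessian_symmetric:
  assumes C2: "C2_at n f G M x" and x: "x \<in> carrier_vec n"
    and a: "a \<in> carrier_vec n" and b: "b \<in> carrier_vec n"
  shows "(M x *\<^sub>v a) \<bullet> b = (M x *\<^sub>v b) \<bullet> a"
proof -
  note self = C2_at_self[OF C2 x]
  obtain r where r: "r > 0"
    and grad: "\<And>y. y \<in> carrier_vec n \<Longrightarrow> euclid_norm (y - x) < r \<Longrightarrow> has_gradient n f (G y) y"
    using C2 unfolding C2_at_def by blast
  have jac: "has_gradient n (\<lambda>y. G y \<bullet> c) (transpose_mat (M x) *\<^sub>v c) x" if "c \<in> carrier_vec n" for c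
    using has_jacobian_imp_has_gradient[of c n x G "M x"] that x self by blast
  have "\<bar>(M x *\<^sub>v a) \<bullet> b - (M x *\<^sub>v b) \<bullet> a\<bar> \<le> 0 + \<epsilon>" if \<epsilon>: "\<epsilon> > 0" for \<epsilon>
  proof -
    have \<epsilon>2: "\<epsilon> / 2 > 0" using \<epsilon> by simp
    obtain \<delta> where \<delta>: "\<delta> > 0" and ab: "\<And>t. 0 < t \<Longrightarrow> t < \<delta> \<Longrightarrow>
        \<bar>f (x + t \<cdot>\<^sub>v b + t \<cdot>\<^sub>v a) - f (x + t \<cdot>\<^sub>v a) - f (x + t \<cdot>\<^sub>v b) + f x
          - t\<^sup>2 * ((M x *\<^sub>v b) \<bullet> a)\<bar> \<le> \<epsilon> / 2 * t\<^sup>2"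
      using second_difference_estimate[OF x a b r grad jac[OF a] \<epsilon>2] transpose_mult_scalar_prod[of "M x" n a b] self a b by auto
    obtain \<delta>' where \<delta>': "\<delta>' > 0" and ba: "\<And>t. 0 < t \<Longrightarrow> t < \<delta>' \<Longrightarrow>
        \<bar>f (x + t \<cdot>\<^sub>v a + t \<cdot>\<^sub>v b) - f (x + t \<cdot>\<^sub>v b) - f (x + t \<cdot>\<^sub>v a) + f x
          - t\<^sup>2 * ((M x *\<^sub>v a) \<bullet> b)\<bar> \<le> \<epsilon> / 2 * t\<^sup>2"
      using second_difference_estimate[OF x b a r grad jac[OF b] \<epsilon>2] transpose_mult_scalar_prod[of "M x" n b a] self a b by auto
    define t where "t = min \<delta> \<delta>' / 2"
    have t: "t > 0" "t < \<delta>" "t < \<delta>'" using \<delta> \<delta>' by (auto simp: t_def)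
    have eq: "x + t \<cdot>\<^sub>v a + t \<cdot>\<^sub>v b = x + t \<cdot>\<^sub>v b + t \<cdot>\<^sub>v a"
      using x a b by (intro eq_vecI) auto
    have "\<bar>t\<^sup>2 * ((M x *\<^sub>v a) \<bullet> b) - t\<^sup>2 * ((M x *\<^sub>v b) \<bullet> a)\<bar> \<le> \<epsilon> / 2 * t\<^sup>2 + \<epsilon> / 2 * t\<^sup>2"
      using ab[OF t(1,2)] ba[OF t(1,3)] unfolding eq by linarith
    also have "\<epsilon> / 2 * t\<^sup>2 + \<epsilon> / 2 * t\<^sup>2 = t\<^sup>2 * \<epsilon>" by simp
    finally have "t\<^sup>2 * \<bar>(M x *\<^sub>v a) \<bullet> b - (M x *\<^sub>v b) \<bullet> a\<bar> \<le> t\<^sup>2 * \<epsilon>"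
      by (simp add: abs_mult mult.commute flip: right_diff_distrib)
    then show ?thesis using t by simp
  qed
  then have "\<bar>(M x *\<^sub>v a) \<bullet> b - (M x *\<^sub>v b) \<bullet> a\<bar> \<le> 0" by (rule field_le_epsilon)
  then show ?thesis by simp
qed

section \<open>The coefficients\<close>

lemma gamma_coef_eq: "gamma_coef k = 1 - (real k / real (k + 1)) ^ 3"
  by (simp add: gamma_coef_def a_coef_def A_coef_def diff_divide_distrib power_divide)

lemma gamma_coef_pos: "0 < gamma_coef k"
proof -
  have "(real k / real (k + 1)) ^ 3 < 1 ^ 3" by (intro power_strict_mono) auto
  then show ?thesis by (simp add: gamma_coef_eq)
qed

lemma gamma_coef_le_1: "gamma_coef k \<le> 1"
  by (simp add: gamma_coef_eq)

text \<open>
  With \<open>s = 1/(k+1)\<close> this is Bernoulli's inequality \<open>1 - (1 - s)\<^sup>3 \<le> 3 s\<close>.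
\<close>

lemma gamma_coef_le: "gamma_coef k \<le> 3 / real (k + 1)"
proof -
  define s where "s = 1 / real (k + 1)"
  have s: "0 \<le> s" "s \<le> 1" by (auto simp: s_def)
  have "real k / real (k + 1) = 1 - s" by (simp add: s_def field_simps)
  then have "gamma_coef k = 3 * s - s\<^sup>2 * (3 - s)"
    unfolding gamma_coef_eq by (simp only:) (simp add: power2_eq_square power3_eq_cube algebra_simps)
  also have "\<dots> \<le> 3 * s" using s by simp
  finally show ?thesis by (simp add: s_def)
qed

lemma gamma_coef_bigo: "gamma_coef \<in> O(\<lambda>k. 1 / real k)"
proof (rule bigoI[of _ 3])
  show "\<forall>\<^sub>F k in sequentially. norm (gamma_coef k) \<le> 3 * norm (1 / real k)"
    using eventually_gt_at_top[of 0]
  proof eventually_elim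
    case (elim k)
    have "gamma_coef k \<le> 3 / real k"
      by (rule order_trans[OF gamma_coef_le]) (use elim in \<open>simp add: frac_le\<close>)
    then show ?case using gamma_coef_pos[of k] by simp
  qed
qed

lemma A_coef_Suc_pos: "0 < A_coef (Suc k)"
  by (simp add: A_coef_def)

lemma a_coef_Suc: "a_coef (Suc k) = A_coef (Suc k) * gamma_coef k"
  using A_coef_Suc_pos[of k] by (simp add: gamma_coef_def)

lemma A_coef_eq: "A_coef k = A_coef (Suc k) * (1 - gamma_coef k)"
  using a_coef_Suc[of k] by (simp add: a_coef_def algebra_simps)

lemma a_coef_pos: "1 \<le> i \<Longrightarrow> 0 < a_coef i"
  by (cases i) (auto simp: a_coef_Suc A_coef_Suc_pos gamma_coef_pos)

lemma sum_a_coef: "(\<Sum>i=1..k. a_coef i) = A_coef k"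
  by (induction k) (auto simp: A_coef_def a_coef_def)

text \<open>
  The weight \<open>A\<^sub>k\<^sub>+\<^sub>1 = (k+1)\<^sup>3\<close> times \<open>\<gamma>\<^bsup>2+\<nu>\<^esup> \<le> (3/(k+1))\<^bsup>2+\<nu>\<^esup>\<close>; the constant is
  \<open>3\<^bsup>2+\<nu>\<^esup> \<le> 3\<^sup>3\<close>.
\<close>

lemma step_error_le:
  assumes "0 \<le> \<nu>" "\<nu> \<le> 1" "0 \<le> D"
  shows "A_coef (Suc k) * ((gamma_coef k * D)\<^sup>2 * (gamma_coef k * D) powr \<nu>)
    \<le> 27 * D powr (2 + \<nu>) * real (Suc k) powr (1 - \<nu>)"
proof -
  define K where "K = real (Suc k)"
  have K: "K > 0" by (simp add: K_def)
  have "(gamma_coef k * D)\<^sup>2 * (gamma_coef k * D) powr \<nu>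
      \<le> (3 / K * D)\<^sup>2 * (3 / K * D) powr \<nu>"
    using gamma_coef_le[of k] gamma_coef_pos[of k] assms
    by (intro mult_mono power_mono powr_mono2 mult_right_mono) (auto simp: K_def)
  also have "\<dots> = (9 * 3 powr \<nu>) * (D\<^sup>2 * D powr \<nu>) / (K\<^sup>2 * K powr \<nu>)"
    using assms K by (simp add: powr_mult powr_divide power_mult_distrib power_divide)
  also have "\<dots> \<le> 27 * (D\<^sup>2 * D powr \<nu>) / (K\<^sup>2 * K powr \<nu>)"
  proof -
    have "3 powr \<nu> \<le> 3 powr (1::real)" using assms by (intro powr_mono) auto
    then show ?thesis using assms K by (intro divide_right_mono mult_right_mono) auto
  qed
  finally have "K ^ 3 * ((gamma_coef k * D)\<^sup>2 * (gamma_coef k * D) powr \<nu>)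
      \<le> K ^ 3 * (27 * (D\<^sup>2 * D powr \<nu>) / (K\<^sup>2 * K powr \<nu>))"
    using K by (intro mult_left_mono) auto
  also have "\<dots> = 27 * (D\<^sup>2 * D powr \<nu>) * (K / K powr \<nu>)"
    using K by (simp add: power2_eq_square power3_eq_cube field_simps)
  also have "K / K powr \<nu> = K powr (1 - \<nu>)" using K by (simp add: powr_diff)
  also have "D\<^sup>2 * D powr \<nu> = D powr (2 + \<nu>)"
    using assms by (cases "D = 0") (auto simp: powr_add)
  finally show ?thesis by (simp add: A_coef_def K_def)
qed

section \<open>Convex combinations and the induced norm\<close>

lemma convex_combination_diff:
  fixes u v w :: "real vec"
  assumes "u \<in> carrier_vec n" "v \<in> carrier_vec n" "w \<in> carrier_vec n"
  shows "(t \<cdot>\<^sub>v u + (1 - t) \<cdot>\<^sub>v w) - (t \<cdot>\<^sub>v v + (1 - t) \<cdot>\<^sub>v w) = t \<cdot>\<^sub>v (u - v)"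
    and "(t \<cdot>\<^sub>v u + (1 - t) \<cdot>\<^sub>v w) - v = t \<cdot>\<^sub>v (u - v) + (1 - t) \<cdot>\<^sub>v (w - v)"
    and "w + t \<cdot>\<^sub>v (u - w) = t \<cdot>\<^sub>v u + (1 - t) \<cdot>\<^sub>v w"
  using assms by (auto intro!: eq_vecI simp: algebra_simps)

text \<open>
  By homogeneity it suffices to consider unit vectors, where both suprema in the induced norm apply.
  Replacing \<open>b\<close> by its negative turns the bound into a two-sided one.
\<close>

lemma induced_norm_bound:
  assumes norm: "norm_on n N" and A: "A \<in> carrier_mat n n"
    and le: "induced_norm n N A \<le> ereal K"
    and a: "a \<in> carrier_vec n" and b: "b \<in> carrier_vec n"
  shows "(A *\<^sub>v a) \<bullet> b \<le> K * N a * N b"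
proof -
  have scale: "N (c \<cdot>\<^sub>v v) = \<bar>c\<bar> * N v" if "v \<in> carrier_vec n" for c v
    using norm that by (auto simp: norm_on_def)
  have nonneg: "0 \<le> N v" and zero: "N v = 0 \<Longrightarrow> v = 0\<^sub>v n" if "v \<in> carrier_vec n" for v
    using norm that by (auto simp: norm_on_def)
  have unit: "(A *\<^sub>v h) \<bullet> h' \<le> K"
    if "h \<in> carrier_vec n" "N h \<le> 1" "h' \<in> carrier_vec n" "N h' \<le> 1" for h h'
  proof -
    have "ereal ((A *\<^sub>v h) \<bullet> h') \<le> dual_norm n N (A *\<^sub>v h)"
      unfolding dual_norm_def using that by (intro SUP_upper) auto
    also have "\<dots> \<le> induced_norm n N A"
      unfolding induced_norm_def using that by (intro SUP_upper) auto
    finally show ?thesis using le by (metis ereal_less_eq(3) order_trans)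
  qed
  have Aa: "A *\<^sub>v a \<in> carrier_vec n" using A a by simp
  show ?thesis
  proof (cases "N a = 0 \<or> N b = 0")
    case True
    then have "(A *\<^sub>v a) \<bullet> b = 0"
    proof
      assume "N a = 0"
      then have "(A *\<^sub>v a) = 0\<^sub>v n" using zero[OF a] A by (auto intro!: eq_vecI)
      then show ?thesis using b by simp
    next
      assume "N b = 0"
      then show ?thesis using zero[OF b] Aa by simp
    qed
    then show ?thesis using True by auto
  next
    case False
    then have pos: "N a > 0" "N b > 0" using nonneg a b by (auto simp: less_le)
    have "(A *\<^sub>v ((1 / N a) \<cdot>\<^sub>v a)) \<bullet> ((1 / N b) \<cdot>\<^sub>v b) \<le> K"
      using a b pos by (intro unit) (auto simp: scale)
    moreover have "A *\<^sub>v ((1 / N a) \<cdot>\<^sub>v a) = (1 / N a) \<cdot>\<^sub>v (A *\<^sub>v a)"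
      using A a by (rule mult_mat_vec)
    ultimately have "((A *\<^sub>v a) \<bullet> b) / (N a * N b) \<le> K"
      using Aa b by (simp add: mult.commute)
    then show ?thesis using pos by (simp add: field_simps)
  qed
qed

section \<open>Convexity, diameter and smoothness on the domain\<close>

locale contracting_newton_run =
  fixes n :: nat and N :: "real vec \<Rightarrow> real" and \<psi> :: "real vec \<Rightarrow> ereal" and f :: "real vec \<Rightarrow> real"
    and grad :: "real vec \<Rightarrow> real vec" and hess :: "real vec \<Rightarrow> real mat"
    and D \<nu> H :: real and x :: "nat \<Rightarrow> real vec"
  assumes norm: "norm_on n N"
    and proper: "proper_fun n \<psi>"
    and convex_psi: "convex_efun n \<psi>"
    and convex_f: "convex_fun_on (edom n \<psi>) f"
    and C2: "\<And>u. u \<in> edom n \<psi> \<Longrightarrow> C2_at n f grad hess u"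
    and diameter: "(SUP u\<in>edom n \<psi>. SUP v\<in>edom n \<psi>. ereal (N (u - v))) = ereal D"
    and nu: "0 \<le> \<nu>" "\<nu> \<le> 1"
    and H_nonneg: "0 \<le> H"
    and holder: "\<And>u v. u \<in> edom n \<psi> \<Longrightarrow> v \<in> edom n \<psi> \<Longrightarrow>
      induced_norm n N (hess u - hess v) \<le> ereal (H * N (u - v) powr \<nu>)"
    and run: "contracting_newton_II n grad hess \<psi> gamma_coef x"
begin

abbreviation "E \<equiv> edom n \<psi>"

text \<open>
  The finite value of \<open>\<psi>\<close> on its domain, which lets the whole analysis take place in the reals.
\<close>

definition psi_val :: "real vec \<Rightarrow> real" where "psi_val u = real_of_ereal (\<psi> u)"

lemma E_carrier: "u \<in> E \<Longrightarrow> u \<in> carrier_vec n"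
  by (simp add: edom_def)

lemma psi_eq: "u \<in> E \<Longrightarrow> \<psi> u = ereal (psi_val u)"
  using proper by (cases "\<psi> u") (auto simp: proper_fun_def edom_def psi_val_def)

lemma psi_outside: "u \<in> carrier_vec n \<Longrightarrow> u \<notin> E \<Longrightarrow> \<psi> u = \<infinity>"
  by (simp add: edom_def)

lemma E_convex:
  assumes "u \<in> E" "v \<in> E" "0 \<le> t" "t \<le> 1"
  shows "t \<cdot>\<^sub>v u + (1 - t) \<cdot>\<^sub>v v \<in> E" "psi_val (t \<cdot>\<^sub>v u + (1 - t) \<cdot>\<^sub>v v) \<le> t * psi_val u + (1 - t) * psi_val v"
proof -
  have "\<psi> (t \<cdot>\<^sub>v u + (1 - t) \<cdot>\<^sub>v v) \<le> ereal t * \<psi> u + ereal (1 - t) * \<psi> v"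
    using convex_psi assms by (auto simp: convex_efun_def E_carrier)
  then have le: "\<psi> (t \<cdot>\<^sub>v u + (1 - t) \<cdot>\<^sub>v v) \<le> ereal (t * psi_val u + (1 - t) * psi_val v)"
    using assms by (simp add: psi_eq)
  then show mem: "t \<cdot>\<^sub>v u + (1 - t) \<cdot>\<^sub>v v \<in> E"
    using E_carrier[OF assms(1)] E_carrier[OF assms(2)] by (auto simp: edom_def intro: le_less_trans)
  show "psi_val (t \<cdot>\<^sub>v u + (1 - t) \<cdot>\<^sub>v v) \<le> t * psi_val u + (1 - t) * psi_val v"
    using le by (simp add: psi_eq[OF mem])
qed

declare E_carrier [simp, intro]

lemma E_dim [simp]: "u \<in> E \<Longrightarrow> dim_vec u = n"
  by (rule carrier_vecD) (rule E_carrier)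

lemma E_segment:
  assumes "u \<in> E" "w \<in> E" "0 \<le> t" "t \<le> 1"
  shows "u + t \<cdot>\<^sub>v (w - u) \<in> E"
  using E_convex(1)[of w u t] convex_combination_diff(3)[of w n u u t] assms by auto

lemma N_nonneg: "u \<in> carrier_vec n \<Longrightarrow> 0 \<le> N u"
  using norm by (simp add: norm_on_def)

lemma N_smult: "u \<in> carrier_vec n \<Longrightarrow> N (c \<cdot>\<^sub>v u) = \<bar>c\<bar> * N u"
  using norm by (simp add: norm_on_def)

lemma N_diff_le_D:
  assumes "u \<in> E" "v \<in> E"
  shows "N (u - v) \<le> D"
proof -
  have "ereal (N (u - v)) \<le> (SUP v\<in>E. ereal (N (u - v)))"
    using assms(2) by (rule SUP_upper)
  also have "\<dots> \<le> ereal D"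
    unfolding diameter[symmetric] using assms(1) by (rule SUP_upper)
  finally show ?thesis by simp
qed

lemma D_nonneg: "0 \<le> D"
proof -
  obtain u where u: "u \<in> E" using proper by (auto simp: proper_fun_def)
  have "0 \<le> N (u - u)" using u by (intro N_nonneg) auto
  then show ?thesis using N_diff_le_D[OF u u] by simp
qed

lemma grad_carrier: "u \<in> E \<Longrightarrow> grad u \<in> carrier_vec n"
  and hess_carrier: "u \<in> E \<Longrightarrow> hess u \<in> carrier_mat n n"
  and grad_deriv: "u \<in> E \<Longrightarrow> has_gradient n f (grad u) u"
  and hess_deriv: "u \<in> E \<Longrightarrow> has_jacobian n grad (hess u) u"
  using C2_at_self[OF C2] by auto

text \<open>
  Convexity bounds the difference quotients of \<open>f\<close> along the segment by \<open>f w - f u\<close>; let the step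
  tend to zero.
\<close>

lemma f_above_tangent:
  assumes u: "u \<in> E" and w: "w \<in> E"
  shows "f u + grad u \<bullet> (w - u) \<le> f w"
proof -
  define \<phi> where "\<phi> t = f (u + t \<cdot>\<^sub>v (w - u))" for t
  have u0: "u + 0 \<cdot>\<^sub>v (w - u) = u" using u w by (intro eq_vecI) auto
  have "(\<phi> has_real_derivative grad u \<bullet> (w - u)) (at 0)"
    unfolding \<phi>_def
    by (rule has_gradient_line)
      (use u w grad_deriv[OF u] in \<open>auto simp only: u0 intro!: minus_carrier_vec\<close>)
  then have "((\<lambda>t. (\<phi> t - \<phi> 0) / (t - 0)) \<longlongrightarrow> grad u \<bullet> (w - u)) (at_right 0)"
    unfolding has_field_derivative_iff by (simp add: filterlim_at_split)
  moreover have "\<forall>\<^sub>F t in at_right 0. (\<phi> t - \<phi> 0) / (t - 0) \<le> f w - f u"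
    using eventually_at_right_real[of 0 1, simplified]
  proof eventually_elim
    case (elim t)
    have "\<phi> t \<le> t * f w + (1 - t) * f u"
      using convex_f u w elim convex_combination_diff(3)[of w n u u t]
      by (auto simp: convex_fun_on_def \<phi>_def)
    then show ?case using elim by (simp add: \<phi>_def u0 field_simps)
  qed
  ultimately have "grad u \<bullet> (w - u) \<le> f w - f u"
    by (rule tendsto_upperbound) simp
  then show ?thesis by simp
qed

text \<open>
  The mean value theorem for \<open>\<nabla>f \<bullet> b\<close> on the segment expresses the left-hand side as the Hessian
  difference between an intermediate point and \<open>u\<close>, applied to \<open>w - u\<close> and \<open>b\<close>. The intermediate
  point is no farther from \<open>u\<close> than \<open>w\<close>, so the Hoelder bound may be taken at \<open>w\<close>.
\<close>

lemma grad_remainder: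
  assumes u: "u \<in> E" and w: "w \<in> E" and b: "b \<in> carrier_vec n"
  shows "grad w \<bullet> b - grad u \<bullet> b - (hess u *\<^sub>v (w - u)) \<bullet> b \<le> H * N (w - u) powr \<nu> * N (w - u) * N b"
proof -
  define d where "d = w - u"
  have d: "d \<in> carrier_vec n" using u w by (simp add: d_def E_carrier minus_carrier_vec)
  define z where "z t = u + t \<cdot>\<^sub>v d" for t
  have zE: "z t \<in> E" if "0 \<le> t" "t \<le> 1" for t
    using E_segment[OF u w that] by (simp add: z_def d_def)
  have der: "((\<lambda>t. grad (z t) \<bullet> b) has_real_derivative (hess (z t) *\<^sub>v d) \<bullet> b) (at t)"
    if "0 \<le> t" "t \<le> 1" for t
  proof -
    have "has_gradient n (\<lambda>y. grad y \<bullet> b) (transpose_mat (hess (z t)) *\<^sub>v b) (z t)"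
      using zE[OF that] b by (intro has_jacobian_imp_has_gradient) (auto simp: grad_carrier hess_deriv)
    then have "((\<lambda>t. grad (z t) \<bullet> b) has_real_derivative (transpose_mat (hess (z t)) *\<^sub>v b) \<bullet> d) (at t)"
      using u d unfolding z_def by (intro has_gradient_line) auto
    then show ?thesis
      using transpose_mult_scalar_prod[OF hess_carrier[OF zE[OF that]] b d] by simp
  qed
  obtain t where t: "0 < t" "t < 1" and mv: "grad (z 1) \<bullet> b - grad (z 0) \<bullet> b = (hess (z t) *\<^sub>v d) \<bullet> b"
    using MVT2[of 0 1, OF _ der] by auto
  have ends: "z 0 = u" "z 1 = w" using u w by (auto simp: z_def d_def intro!: eq_vecI)
  have zt: "z t \<in> E" using zE t by simp
  have "z t - u = t \<cdot>\<^sub>v d" using u d by (auto simp: z_def intro!: eq_vecI)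
  then have "N (z t - u) \<le> N d" using t d N_nonneg[OF d] by (simp add: N_smult mult_left_le_one_le)
  then have powr: "N (z t - u) powr \<nu> \<le> N d powr \<nu>"
    using nu zt u by (intro powr_mono2 N_nonneg) auto
  have "grad w \<bullet> b - grad u \<bullet> b - (hess u *\<^sub>v d) \<bullet> b = ((hess (z t) - hess u) *\<^sub>v d) \<bullet> b"
    using mv hess_carrier[OF zt] hess_carrier[OF u] d b
    by (simp add: ends minus_mult_distrib_mat_vec minus_scalar_prod_distrib[of _ n])
  also have "\<dots> \<le> H * N (z t - u) powr \<nu> * N d * N b"
    using hess_carrier[OF u] by (intro induced_norm_bound[OF norm _ holder[OF zt u] d b]) auto
  also have "\<dots> \<le> H * N d powr \<nu> * N d * N b"
    using powr H_nonneg N_nonneg d b by (intro mult_right_mono mult_left_mono) auto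
  finally show ?thesis by (simp add: d_def)
qed

section \<open>The subproblem\<close>

lemma contracted_psi_self: "u \<in> E \<Longrightarrow> contracted_psi n \<psi> t u u = \<psi> u"
proof -
  assume u: "u \<in> E"
  then have "u = t \<cdot>\<^sub>v u + (1 - t) \<cdot>\<^sub>v u" by (auto intro!: eq_vecI simp: algebra_simps)
  then show ?thesis using u by (auto simp: contracted_psi_def)
qed

lemma iterate_minimal:
  "x (Suc k) \<in> carrier_vec n"
  "z \<in> carrier_vec n \<Longrightarrow> newton_model n grad hess \<psi> (gamma_coef k) (x k) (x (Suc k))
    \<le> newton_model n grad hess \<psi> (gamma_coef k) (x k) z"
  using run by (auto simp: contracting_newton_II_def argmin_on_def)

text \<open>
  The model is finite at the current point, which belongs to the contracted domain, hence also at
  the minimiser.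
\<close>

lemma iterate_step:
  assumes "x k \<in> E"
  shows "\<exists>v\<in>E. x (Suc k) = gamma_coef k \<cdot>\<^sub>v v + (1 - gamma_coef k) \<cdot>\<^sub>v x k"
proof (rule ccontr)
  assume "\<not> ?thesis"
  then have "newton_model n grad hess \<psi> (gamma_coef k) (x k) (x (Suc k)) = \<infinity>"
    by (auto simp: newton_model_def contracted_psi_def)
  moreover have "newton_model n grad hess \<psi> (gamma_coef k) (x k) (x k) < \<infinity>"
    using assms by (simp add: newton_model_def contracted_psi_self psi_eq)
  ultimately show False using iterate_minimal(2)[of "x k" k] assms by auto
qed

lemma iterate_in_E: "x k \<in> E"
proof (induction k)
  case 0
  then show ?case using run by (simp add: contracting_newton_II_def)
next
  case (Suc k)
  obtain v where "v \<in> E" "x (Suc k) = gamma_coef k \<cdot>\<^sub>v v + (1 - gamma_coef k) \<cdot>\<^sub>v x k"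
    using iterate_step[OF Suc] by blast
  then show ?case
    using E_convex(1)[of v "x k" "gamma_coef k"] Suc gamma_coef_pos[of k] gamma_coef_le_1[of k] by simp
qed

text \<open>
  Move from the minimiser towards \<open>y\<close> by a fraction \<open>t\<close>. The contracted domain is convex, so this is
  feasible, and minimality says that \<open>t p + t\<^sup>2 q \<ge> 0\<close>, where \<open>p\<close> collects the first-order terms and
  the chord of \<open>\<psi>\<close>. The conclusion is \<open>p \<ge> 0\<close>. The cross terms of the quadratic form add up to
  twice one of them by the symmetry of the Hessian.
\<close>

lemma first_order_optimality:
  fixes k :: nat
  defines "\<gamma> \<equiv> gamma_coef k"
  assumes v: "v \<in> E"
  defines "y \<equiv> \<gamma> \<cdot>\<^sub>v v + (1 - \<gamma>) \<cdot>\<^sub>v x k"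
  shows "psi_val (x (Suc k)) \<le> psi_val y + grad (x k) \<bullet> (y - x (Suc k))
    + (hess (x k) *\<^sub>v (x (Suc k) - x k)) \<bullet> (y - x (Suc k))"
proof -
  have \<gamma>: "0 < \<gamma>" "\<gamma> \<le> 1" by (simp_all add: \<gamma>_def gamma_coef_pos gamma_coef_le_1)
  let ?u = "x k" and ?w = "x (Suc k)"
  have u: "?u \<in> E" and w: "?w \<in> E" by (rule iterate_in_E)+
  have y: "y \<in> E" unfolding y_def using E_convex(1)[OF v u] \<gamma> by simp
  obtain v' where v': "v' \<in> E" and w_eq: "?w = \<gamma> \<cdot>\<^sub>v v' + (1 - \<gamma>) \<cdot>\<^sub>v ?u"
    using iterate_step[OF u] by (auto simp: \<gamma>_def)
  define e where "e = ?w - ?u"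
  define d where "d = y - ?w"
  have e: "e \<in> carrier_vec n" and d: "d \<in> carrier_vec n"
    using u w y by (auto simp: e_def d_def)
  define M where "M = hess ?u"
  have M: "M \<in> carrier_mat n n" using hess_carrier[OF u] by (simp add: M_def)
  have g: "grad ?u \<in> carrier_vec n" by (rule grad_carrier[OF u])
  have Mc: "M *\<^sub>v c \<in> carrier_vec n" if "c \<in> carrier_vec n" for c using M that by simp
  have sym: "(M *\<^sub>v d) \<bullet> e = (M *\<^sub>v e) \<bullet> d"
    unfolding M_def by (rule C2_at_hessian_symmetric[OF C2[OF u]]) (use u d e in auto)
  have model: "newton_model n grad hess \<psi> \<gamma> ?u c
      = ereal (grad ?u \<bullet> (c - ?u) + 1 / 2 * ((M *\<^sub>v (c - ?u)) \<bullet> (c - ?u)) + psi_val c)"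
    if "c \<in> E" "\<exists>v\<in>E. c = \<gamma> \<cdot>\<^sub>v v + (1 - \<gamma>) \<cdot>\<^sub>v ?u" for c
    using that by (auto simp: newton_model_def contracted_psi_def M_def psi_eq)
  have w_contr: "\<exists>v\<in>E. ?w = \<gamma> \<cdot>\<^sub>v v + (1 - \<gamma>) \<cdot>\<^sub>v ?u"
    using v' w_eq by blast
  have "0 \<le> t * (grad ?u \<bullet> d + (M *\<^sub>v e) \<bullet> d + psi_val y - psi_val ?w) + t\<^sup>2 * (1 / 2 * ((M *\<^sub>v d) \<bullet> d))"
    if t: "0 < t" "t \<le> 1" for t
  proof -
    define c where "c = t \<cdot>\<^sub>v y + (1 - t) \<cdot>\<^sub>v ?w"
    have c: "c \<in> E" and pc: "psi_val c \<le> t * psi_val y + (1 - t) * psi_val ?w"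
      using E_convex[OF y w, of t] t by (auto simp: c_def)
    have "c = \<gamma> \<cdot>\<^sub>v (t \<cdot>\<^sub>v v + (1 - t) \<cdot>\<^sub>v v') + (1 - \<gamma>) \<cdot>\<^sub>v ?u"
      unfolding c_def w_eq y_def using v v' u
      by (intro eq_vecI) (auto simp: algebra_simps)
    then have c_contr: "\<exists>v\<in>E. c = \<gamma> \<cdot>\<^sub>v v + (1 - \<gamma>) \<cdot>\<^sub>v ?u"
      using E_convex(1)[OF v v', of t] t by auto
    have "newton_model n grad hess \<psi> \<gamma> ?u ?w \<le> newton_model n grad hess \<psi> \<gamma> ?u c"
      unfolding \<gamma>_def using c by (intro iterate_minimal) auto
    then have le: "grad ?u \<bullet> e + 1 / 2 * ((M *\<^sub>v e) \<bullet> e) + psi_val ?w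
        \<le> grad ?u \<bullet> (c - ?u) + 1 / 2 * ((M *\<^sub>v (c - ?u)) \<bullet> (c - ?u)) + psi_val c"
      unfolding model[OF c c_contr] model[OF w w_contr] by (simp add: e_def)
    have cu: "c - ?u = e + t \<cdot>\<^sub>v d"
      unfolding c_def e_def d_def using u w y by (intro eq_vecI) (auto simp: algebra_simps)
    have "M *\<^sub>v (e + t \<cdot>\<^sub>v d) = M *\<^sub>v e + t \<cdot>\<^sub>v (M *\<^sub>v d)"
      using M e d by (simp add: mult_add_distrib_mat_vec mult_mat_vec)
    then have quad: "(M *\<^sub>v (c - ?u)) \<bullet> (c - ?u)
        = (M *\<^sub>v e) \<bullet> e + 2 * t * ((M *\<^sub>v e) \<bullet> d) + t\<^sup>2 * ((M *\<^sub>v d) \<bullet> d)"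
      unfolding cu using \<open>M *\<^sub>v (e + t \<cdot>\<^sub>v d) = _\<close> Mc[OF e] Mc[OF d] e d sym
      by (simp add: scalar_prod_add_distrib[of _ n] add_scalar_prod_distrib[of _ n]
          power2_eq_square algebra_simps)
    have "grad ?u \<bullet> (c - ?u) = grad ?u \<bullet> e + t * (grad ?u \<bullet> d)"
      unfolding cu using g e d by (simp add: scalar_prod_add_distrib[of _ n])
    then show ?thesis using le pc unfolding quad by (simp add: algebra_simps)
  qed
  then have "0 \<le> grad ?u \<bullet> d + (M *\<^sub>v e) \<bullet> d + psi_val y - psi_val ?w"
    by (rule nonneg_linear_coeff)
  then show ?thesis by (simp add: d_def e_def M_def)
qed

text \<open>
  The induction step divided by \<open>A\<^sub>k\<^sub>+\<^sub>1\<close>: the value at the next iterate is, up to the error, at most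
  the convex combination of the current value and of the next linearisation at \<open>v\<close>.
\<close>

lemma one_step:
  fixes k :: nat
  defines "\<gamma> \<equiv> gamma_coef k"
  assumes v: "v \<in> E"
  shows "f (x (Suc k)) + psi_val (x (Suc k)) - H * ((\<gamma> * D)\<^sup>2 * (\<gamma> * D) powr \<nu>)
    \<le> (1 - \<gamma>) * (f (x k) + psi_val (x k))
      + \<gamma> * (f (x (Suc k)) + grad (x (Suc k)) \<bullet> (v - x (Suc k)) + psi_val v)"
proof -
  have \<gamma>: "0 < \<gamma>" "\<gamma> \<le> 1" by (simp_all add: \<gamma>_def gamma_coef_pos gamma_coef_le_1)
  let ?u = "x k" and ?w = "x (Suc k)"
  have u: "?u \<in> E" and w: "?w \<in> E" by (rule iterate_in_E)+
  define y where "y = \<gamma> \<cdot>\<^sub>v v + (1 - \<gamma>) \<cdot>\<^sub>v ?u"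
  have y: "y \<in> E" and py: "psi_val y \<le> \<gamma> * psi_val v + (1 - \<gamma>) * psi_val ?u"
    unfolding y_def using E_convex[OF v u] \<gamma> by auto
  obtain v' where v': "v' \<in> E" and w_eq: "?w = \<gamma> \<cdot>\<^sub>v v' + (1 - \<gamma>) \<cdot>\<^sub>v ?u"
    using iterate_step[OF u] by (auto simp: \<gamma>_def)
  have g: "grad ?w \<in> carrier_vec n" "grad ?u \<in> carrier_vec n"
    "hess ?u *\<^sub>v (?w - ?u) \<in> carrier_vec n"
    using grad_carrier hess_carrier[OF u] u w by (auto intro!: mult_mat_vec_carrier)
  have step: "N (?w - ?u) \<le> \<gamma> * D"
  proof -
    have "?w - ?u = \<gamma> \<cdot>\<^sub>v (v' - ?u)"
      unfolding w_eq using v' u by (intro eq_vecI) (auto simp: algebra_simps)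
    then have "N (?w - ?u) = \<gamma> * N (v' - ?u)" using \<gamma> v' u by (simp add: N_smult)
    then show ?thesis using \<gamma> N_diff_le_D[OF v' u] by simp
  qed
  have gap: "N (?w - y) \<le> \<gamma> * D"
  proof -
    have "?w - y = \<gamma> \<cdot>\<^sub>v (v' - v)"
      unfolding w_eq y_def by (rule convex_combination_diff) (use v v' u in auto)
    then have "N (?w - y) = \<gamma> * N (v' - v)" using \<gamma> v' v by (simp add: N_smult)
    then show ?thesis using \<gamma> N_diff_le_D[OF v' v] by simp
  qed
  have nn: "0 \<le> N (?w - ?u)" "0 \<le> N (?w - y)" "0 \<le> \<gamma> * D"
    using u w y \<gamma> D_nonneg by (auto intro!: N_nonneg)
  have "grad ?w \<bullet> (?w - y) - grad ?u \<bullet> (?w - y) - (hess ?u *\<^sub>v (?w - ?u)) \<bullet> (?w - y)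
      \<le> H * N (?w - ?u) powr \<nu> * N (?w - ?u) * N (?w - y)"
    using w y by (intro grad_remainder[OF u w]) auto
  also have "\<dots> \<le> H * (\<gamma> * D) powr \<nu> * (\<gamma> * D) * (\<gamma> * D)"
    using step gap nn H_nonneg nu by (intro mult_mono powr_mono2) auto
  also have "\<dots> = H * ((\<gamma> * D)\<^sup>2 * (\<gamma> * D) powr \<nu>)" by (simp add: power2_eq_square)
  finally have rem: "grad ?w \<bullet> (?w - y) - grad ?u \<bullet> (?w - y) - (hess ?u *\<^sub>v (?w - ?u)) \<bullet> (?w - y)
      \<le> H * ((\<gamma> * D)\<^sup>2 * (\<gamma> * D) powr \<nu>)" .
  \<comment> \<open>The remainder estimate is one-sided and is used in the direction opposite to that of the
  optimality condition.\<close>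
  have flip: "c \<bullet> (?w - y) = - (c \<bullet> (y - ?w))" if "c \<in> carrier_vec n" for c
    using that w y by (simp add: scalar_prod_minus_distrib[of _ n])
  have opt: "psi_val ?w \<le> psi_val y + grad ?u \<bullet> (y - ?w) + (hess ?u *\<^sub>v (?w - ?u)) \<bullet> (y - ?w)"
    using first_order_optimality[OF v, of k] by (simp add: y_def \<gamma>_def)
  have "y - ?w = \<gamma> \<cdot>\<^sub>v (v - ?w) + (1 - \<gamma>) \<cdot>\<^sub>v (?u - ?w)"
    unfolding y_def by (rule convex_combination_diff) (use v w u in auto)
  then have split: "grad ?w \<bullet> (y - ?w) = \<gamma> * (grad ?w \<bullet> (v - ?w)) + (1 - \<gamma>) * (grad ?w \<bullet> (?u - ?w))"
    using g v u w by (simp add: scalar_prod_add_distrib[of _ n])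
  have "(1 - \<gamma>) * (f ?w + grad ?w \<bullet> (?u - ?w)) \<le> (1 - \<gamma>) * f ?u"
    using f_above_tangent[OF w u] \<gamma> by (intro mult_left_mono) auto
  then show ?thesis
    using rem opt py split unfolding flip[OF g(1)] flip[OF g(2)] flip[OF g(3)]
    by (simp add: algebra_simps)
qed

section \<open>The estimating functions\<close>

definition error_const :: real where "error_const = 27 * H * D powr (2 + \<nu>)"

text \<open>
  At \<open>k = 0\<close> both sides vanish since \<open>A\<^sub>0 = 0\<close>. The accumulated
  error is kept in the form \<open>k * k\<^bsup>1-\<nu>\<^esup>\<close>, which absorbs one more summand
  \<open>(k+1)\<^bsup>1-\<nu>\<^esup>\<close> because \<open>k\<^bsup>1-\<nu>\<^esup> \<le> (k+1)\<^bsup>1-\<nu>\<^esup>\<close>.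
\<close>

lemma estimating_sequence:
  assumes v: "v \<in> E"
  shows "A_coef k * (f (x k) + psi_val (x k)) - error_const * (real k * real k powr (1 - \<nu>))
    \<le> (\<Sum>i=1..k. a_coef i * (f (x i) + grad (x i) \<bullet> (v - x i) + psi_val v))"
proof (induction k)
  case 0
  show ?case by (simp add: A_coef_def)
next
  case (Suc k)
  define \<gamma> where "\<gamma> = gamma_coef k"
  define A where "A = A_coef (Suc k)"
  define err where "err = (\<gamma> * D)\<^sup>2 * (\<gamma> * D) powr \<nu>"
  define L where "L = f (x (Suc k)) + grad (x (Suc k)) \<bullet> (v - x (Suc k)) + psi_val v"
  have A: "A > 0" by (simp add: A_def A_coef_Suc_pos)
  have "A * (f (x (Suc k)) + psi_val (x (Suc k)) - H * err)
      \<le> A * ((1 - \<gamma>) * (f (x k) + psi_val (x k)) + \<gamma> * L)"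
    using one_step[OF v, of k] A by (intro mult_left_mono) (auto simp: \<gamma>_def err_def L_def)
  also have "\<dots> = A_coef k * (f (x k) + psi_val (x k)) + a_coef (Suc k) * L"
    unfolding A_coef_eq[of k] a_coef_Suc A_def[symmetric] \<gamma>_def[symmetric] by (simp add: algebra_simps)
  finally have main: "A * (f (x (Suc k)) + psi_val (x (Suc k))) - H * (A * err)
      \<le> A_coef k * (f (x k) + psi_val (x k)) + a_coef (Suc k) * L" by (simp add: algebra_simps)
  have "H * (A * err) \<le> H * (27 * D powr (2 + \<nu>) * real (Suc k) powr (1 - \<nu>))"
    using step_error_le[OF nu D_nonneg, of k] H_nonneg
    by (intro mult_left_mono) (auto simp: A_def err_def \<gamma>_def)
  then have err: "H * (A * err) \<le> error_const * real (Suc k) powr (1 - \<nu>)" by (simp add: error_const_def)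
  have "real k powr (1 - \<nu>) \<le> real (Suc k) powr (1 - \<nu>)" using nu by (intro powr_mono2) auto
  then have "error_const * (real k * real k powr (1 - \<nu>)) \<le> error_const * (real k * real (Suc k) powr (1 - \<nu>))"
    using H_nonneg by (intro mult_left_mono) (auto simp: error_const_def)
  moreover have "error_const * (real (Suc k) * real (Suc k) powr (1 - \<nu>))
      = error_const * (real k * real (Suc k) powr (1 - \<nu>)) + error_const * real (Suc k) powr (1 - \<nu>)"
    by (simp add: algebra_simps)
  ultimately show ?case using main err Suc.IH by (simp add: A_def L_def)
qed

lemma est_fun_eq:
  assumes "v \<in> E"
  shows "est_fun f grad \<psi> x k v = ereal (\<Sum>i=1..k. a_coef i * (f (x i) + grad (x i) \<bullet> (v - x i) + psi_val v))"
  using assms by (simp add: est_fun_def psi_eq)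

lemma est_fun_outside:
  assumes "v \<in> carrier_vec n" "v \<notin> E" "1 \<le> k"
  shows "est_fun f grad \<psi> x k v = \<infinity>"
  unfolding est_fun_def sum_Pinfty
proof (intro conjI bexI[of _ 1])
  show "ereal (a_coef 1) * (ereal (f (x 1) + grad (x 1) \<bullet> (v - x 1)) + \<psi> v) = \<infinity>"
    using a_coef_pos[of 1] by (simp add: psi_outside[OF assms(1,2)])
qed (use assms in auto)

lemma est_fun_le_objective:
  assumes "v \<in> E"
  shows "(\<Sum>i=1..k. a_coef i * (f (x i) + grad (x i) \<bullet> (v - x i) + psi_val v)) \<le> A_coef k * (f v + psi_val v)"
proof -
  have "(\<Sum>i=1..k. a_coef i * (f (x i) + grad (x i) \<bullet> (v - x i) + psi_val v))
      \<le> (\<Sum>i=1..k. a_coef i * (f v + psi_val v))"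
    using f_above_tangent[OF iterate_in_E assms] a_coef_pos
    by (intro sum_mono mult_left_mono) (auto intro: less_imp_le)
  also have "\<dots> = A_coef k * (f v + psi_val v)"
    by (simp only: sum_a_coef flip: sum_distrib_right)
  finally show ?thesis .
qed

text \<open>
  On the domain \<open>\<phi>\<^sub>k\<close> lies above \<open>A\<^sub>k F(x\<^sub>k) - B\<^sub>k\<close> and below \<open>A\<^sub>k F\<close>; outside it is infinite. Hence its minimum is finite, and after
  division by \<open>A\<^sub>k\<close> it is both a lower bound for the optimal value and close to \<open>F(x\<^sub>k)\<close>.
\<close>

lemma certificate_bounds:
  assumes k: "1 \<le> k"
  shows "objective f \<psi> (x k) - opt_value n f \<psi> \<le> accuracy_cert n f grad \<psi> x k"
    and "accuracy_cert n f grad \<psi> x k \<le> ereal (27 * (H * D powr (2 + \<nu>) / real k powr (1 + \<nu>)))"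
proof -
  define F where "F = f (x k) + psi_val (x k)"
  define Bk where "Bk = error_const * (real k * real k powr (1 - \<nu>))"
  have A: "A_coef k > 0" using k by (simp add: A_coef_def)
  have obj: "objective f \<psi> (x k) = ereal F"
    using psi_eq[OF iterate_in_E] by (simp add: objective_def F_def)
  have lower: "ereal (A_coef k * F - Bk) \<le> est_min n f grad \<psi> x k"
    unfolding est_min_def
  proof (rule INF_greatest)
    fix v :: "real vec" assume "v \<in> carrier_vec n"
    then show "ereal (A_coef k * F - Bk) \<le> est_fun f grad \<psi> x k v"
      using est_fun_outside[of v k] estimating_sequence[of v k] k
      by (cases "v \<in> E") (auto simp: est_fun_eq F_def Bk_def)
  qed
  have upper: "est_min n f grad \<psi> x k \<le> ereal (A_coef k * (f v + psi_val v))" if "v \<in> E" for v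
  proof -
    have "est_min n f grad \<psi> x k \<le> est_fun f grad \<psi> x k v"
      unfolding est_min_def using that by (intro INF_lower) auto
    also have "\<dots> \<le> ereal (A_coef k * (f v + psi_val v))"
      using est_fun_le_objective[OF that, of k] by (simp add: est_fun_eq[OF that])
    finally show ?thesis .
  qed
  obtain m where m: "est_min n f grad \<psi> x k = ereal m"
    using lower upper[OF iterate_in_E[of 0]] by (cases "est_min n f grad \<psi> x k") auto
  have cert: "accuracy_cert n f grad \<psi> x k = ereal (F - m / A_coef k)"
    using A by (simp add: accuracy_cert_def obj m)
  have "ereal (m / A_coef k) \<le> opt_value n f \<psi>"
    unfolding opt_value_def
  proof (rule INF_greatest)
    fix v :: "real vec" assume v: "v \<in> carrier_vec n"
    show "ereal (m / A_coef k) \<le> objective f \<psi> v"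
    proof (cases "v \<in> E")
      case True
      then have "m \<le> A_coef k * (f v + psi_val v)" using upper[OF True] m by simp
      then show ?thesis using A by (simp add: objective_def psi_eq[OF True] field_simps)
    next
      case False
      then show ?thesis by (simp add: objective_def psi_outside[OF v])
    qed
  qed
  then show "objective f \<psi> (x k) - opt_value n f \<psi> \<le> accuracy_cert n f grad \<psi> x k"
    unfolding cert obj by (cases "opt_value n f \<psi>") auto
  have kpos: "0 < real k" using k by simp
  have "A_coef k * F - Bk \<le> m" using lower m by simp
  then have "F * A_coef k - m \<le> Bk" by (simp add: mult.commute)
  then have "(F * A_coef k - m) / A_coef k \<le> Bk / A_coef k"
    using A by (intro divide_right_mono) auto
  then have "F - m / A_coef k \<le> Bk / A_coef k"
    using A by (simp add: diff_divide_distrib)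
  also have "Bk / A_coef k = error_const * (real k powr (1 - \<nu>) / real k powr 2)"
    using kpos by (simp add: Bk_def A_coef_def power2_eq_square power3_eq_cube)
  also have "real k powr (1 - \<nu>) / real k powr 2 = 1 / real k powr (1 + \<nu>)"
    using kpos by (simp add: field_simps flip: powr_add)
  finally show "accuracy_cert n f grad \<psi> x k \<le> ereal (27 * (H * D powr (2 + \<nu>) / real k powr (1 + \<nu>)))"
    by (simp add: cert error_const_def)
qed

end

section \<open>The rate of convergence\<close>

theorem theorem3:
  shows "(\<forall>k. gamma_coef k = 1 - (real k / real (k + 1)) ^ 3) \<and>
    gamma_coef \<in> O(\<lambda>k. 1 / real k) \<and>
    (\<exists>C::real. C > 0 \<and>
      (\<forall>(n::nat) (N :: real vec \<Rightarrow> real) (\<psi> :: real vec \<Rightarrow> ereal) (f :: real vec \<Rightarrow> real)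
         (grad :: real vec \<Rightarrow> real vec) (hess :: real vec \<Rightarrow> real mat)
         (D::real) (\<nu>::real) (H::real) (x :: nat \<Rightarrow> real vec).
        norm_on n N \<and>
        proper_fun n \<psi> \<and> closed_fun n \<psi> \<and> convex_efun n \<psi> \<and>
        convex_fun_on (edom n \<psi>) f \<and>
        (\<forall>u\<in>edom n \<psi>. C2_at n f grad hess u) \<and>
        (SUP u\<in>edom n \<psi>. SUP v\<in>edom n \<psi>. ereal (N (u - v))) = ereal D \<and>
        0 \<le> \<nu> \<and> \<nu> \<le> 1 \<and> 0 \<le> H \<and>
        (\<forall>u\<in>edom n \<psi>. \<forall>v\<in>edom n \<psi>.
           induced_norm n N (hess u - hess v) \<le> ereal (H * N (u - v) powr \<nu>)) \<and>
        contracting_newton_II n grad hess \<psi> gamma_coef x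
        \<longrightarrow>
        (\<forall>k\<ge>1.
           objective f \<psi> (x k) - opt_value n f \<psi> \<le> accuracy_cert n f grad \<psi> x k \<and>
           accuracy_cert n f grad \<psi> x k
             \<le> ereal (C * (H * D powr (2 + \<nu>) / real k powr (1 + \<nu>))))))"
proof (intro conjI exI[of _ "27::real"] allI impI, goal_cases)
  case (1 k)
  show ?case by (rule gamma_coef_eq)
next
  case 2
  show ?case by (rule gamma_coef_bigo)
next
  case 3
  show ?case by simp
next
  case (4 n N \<psi> f grad hess D \<nu> H x k)
  then interpret contracting_newton_run n N \<psi> f grad hess D \<nu> H x
    by unfold_locales auto
  show ?case using 4 by (intro certificate_bounds) simp
next
  case (5 n N \<psi> f grad hess D \<nu> H x k)
  then interpret contracting_newton_run n N \<psi> f grad hess D \<nu> H x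
    by unfold_locales auto
  show ?case using 5 by (intro certificate_bounds) simp
qed

end
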